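(* Let $X$ be a Hausdorff topological space and $\lambda:\mathcal{K}(X)\rightarrow[0,+\infty)$ a regular content. Then $\lambda$ is an almost Boolean valuation on $\mathcal{K}(X)$.
   Context: $\mathcal{K}(X)$ is the set of compact subsets of $X$ ordered by inclusion; for $X$ Hausdorff it is a distributive lattice under $\cup,\cap$ with bottom $\emptyset$. A content is a function $\lambda:\mathcal{K}(X)\to[0,+\infty)$ that is monotone ($C\subset D$ implies $\lambda(C)\le\lambda(D)$), subadditive ($\lambda(C\cup D)\le\lambda(C)+\lambda(D)$), and additive on disjoint pairs ($\lambda(C\cup D)=\lambda(C)+\lambda(D)$ if $C\cap D=\emptyset$). For compact $K_1,K_2$ write $K_1\ll K_2$ if there is an open $U$ with $K_1\subset U\subset K_2$. A content is regular if $\lambda(K)=\inf\{\lambda(K')\mid K\ll K',\ K'\text{ compact}\}$ for all compact $K$ (infimum in $[0,+\infty]$). A finite valuation on a lower bounded distributive lattice $D$ is a monotone map $\mu:D\to[0,\infty)$ with $\mu(0)=0$ and $\mu(p)+\mu(q)=\mu(p\vee q)+\mu(p\wedge q)$. It is almost Boolean if for any $c\in D$, any ascending sequence $c_0\le c_1\le\cdots\le c$ of elements below $c$, and any $\epsilon>0$, there exist $N\in\mathbb{N}$ and $d\le c$ such that $\mu(d\wedge c_n)=0$ for all $n\in\mathbb{N}$ and $\mu(c)-\mu(d\vee c_N)<\epsilon$. *)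

theory Defs
  imports "HOL-Analysis.Analysis" "HOL-Algebra.Lattice"
begin

section \<open>Valuations on lower bounded distributive lattices\<close>

locale lower_bounded_distrib_lattice =
  Lattice.lattice L + weak_partial_order_bottom L for L (structure) +
  assumes meet_join_distrib:
    "\<lbrakk>x \<in> carrier L; y \<in> carrier L; z \<in> carrier L\<rbrakk>
      \<Longrightarrow> x \<sqinter> (y \<squnion> z) = (x \<sqinter> y) \<squnion> (x \<sqinter> z)"

text \<open>Only the values on the carrier matter; the codomain \<open>[0,\<infinity>)\<close> is expressed by \<open>nonneg\<close>.\<close>

locale finite_valuation = lower_bounded_distrib_lattice L for L (structure) +
  fixes \<mu> :: "'a \<Rightarrow> real"
  assumes nonneg: "x \<in> carrier L \<Longrightarrow> 0 \<le> \<mu> x"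
    and mono: "\<lbrakk>x \<in> carrier L; y \<in> carrier L; x \<sqsubseteq> y\<rbrakk> \<Longrightarrow> \<mu> x \<le> \<mu> y"
    and bottom: "\<mu> \<bottom> = 0"
    and modular: "\<lbrakk>x \<in> carrier L; y \<in> carrier L\<rbrakk>
      \<Longrightarrow> \<mu> x + \<mu> y = \<mu> (x \<squnion> y) + \<mu> (x \<sqinter> y)"

locale almost_Boolean_valuation = finite_valuation L \<mu> for L (structure) and \<mu> +
  assumes almost_Boolean:
    "\<And>c (s :: nat \<Rightarrow> 'a) (\<epsilon> :: real).
      \<lbrakk>c \<in> carrier L;
       \<And>n. s n \<in> carrier L; \<And>n. s n \<sqsubseteq> s (Suc n); \<And>n. s n \<sqsubseteq> c;
       0 < \<epsilon>\<rbrakk>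
      \<Longrightarrow> \<exists>N. \<exists>d\<in>carrier L. d \<sqsubseteq> c \<and> (\<forall>n. \<mu> (d \<sqinter> s n) = 0) \<and> \<mu> c - \<mu> (d \<squnion> s N) < \<epsilon>"


section \<open>The lattice of compact subsets\<close>

definition compacts :: "'a topology \<Rightarrow> 'a set gorder" where
  "compacts X = \<lparr>carrier = {K. compactin X K}, eq = (=), le = (\<subseteq>)\<rparr>"

lemma carrier_compacts [simp]: "K \<in> carrier (compacts X) \<longleftrightarrow> compactin X K"
  and eq_compacts [simp]: "eq (compacts X) = (=)"
  and le_compacts [simp]: "le (compacts X) = (\<subseteq>)"
  by (simp_all add: compacts_def)

lemma partial_order_compacts: "partial_order (compacts X)"
  by unfold_locales auto

lemma least_join_compacts:
  assumes "compactin X K" "compactin X K'"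
  shows "least (compacts X) (K \<union> K') (Upper (compacts X) {K, K'})"
  using assms by (auto simp: least_def Upper_def compactin_Un)

lemma greatest_meet_compacts:
  assumes "Hausdorff_space X" "compactin X K" "compactin X K'"
  shows "greatest (compacts X) (K \<inter> K') (Lower (compacts X) {K, K'})"
  using assms by (auto simp: greatest_def Lower_def compactin_Int)

lemma least_bottom_compacts: "least (compacts X) {} (carrier (compacts X))"
  by (auto simp: least_def)

lemma join_compacts:
  assumes "compactin X K" "compactin X K'"
  shows "K \<squnion>\<^bsub>compacts X\<^esub> K' = K \<union> K'"
proof -
  interpret partial_order "compacts X" by (rule partial_order_compacts)
  show ?thesis
    unfolding join_def Lattice.sup_def
    using least_join_compacts[OF assms] by (metis (mono_tags) least_unique someI)
qed

lemma meet_compacts: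
  assumes "Hausdorff_space X" "compactin X K" "compactin X K'"
  shows "K \<sqinter>\<^bsub>compacts X\<^esub> K' = K \<inter> K'"
proof -
  interpret partial_order "compacts X" by (rule partial_order_compacts)
  show ?thesis
    unfolding meet_def Lattice.inf_def
    using greatest_meet_compacts[OF assms] by (metis (mono_tags) greatest_unique someI)
qed

lemma bottom_compacts: "\<bottom>\<^bsub>compacts X\<^esub> = {}"
proof -
  interpret partial_order "compacts X" by (rule partial_order_compacts)
  show ?thesis
    unfolding bottom_def
    using least_bottom_compacts by (metis (mono_tags) least_unique someI)
qed

lemma lower_bounded_distrib_lattice_compacts:
  assumes "Hausdorff_space X"
  shows "lower_bounded_distrib_lattice (compacts X)"
proof -
  interpret partial_order "compacts X" by (rule partial_order_compacts)
  show ?thesis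
    using assms least_join_compacts greatest_meet_compacts least_bottom_compacts
    by unfold_locales
      (fastforce simp: join_compacts meet_compacts compactin_Un compactin_Int)+
qed


section \<open>Regular contents\<close>

locale topological_content =
  fixes X :: "'a topology" and lam :: "'a set \<Rightarrow> real"
  assumes nonneg: "compactin X C \<Longrightarrow> 0 \<le> lam C"
    and mono: "\<lbrakk>compactin X C; compactin X D; C \<subseteq> D\<rbrakk> \<Longrightarrow> lam C \<le> lam D"
    and subadditive: "\<lbrakk>compactin X C; compactin X D\<rbrakk> \<Longrightarrow> lam (C \<union> D) \<le> lam C + lam D"
    and additive: "\<lbrakk>compactin X C; compactin X D; C \<inter> D = {}\<rbrakk>
      \<Longrightarrow> lam (C \<union> D) = lam C + lam D"

definition way_inside :: "'a topology \<Rightarrow> 'a set \<Rightarrow> 'a set \<Rightarrow> bool" where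
  "way_inside X K K' \<longleftrightarrow> (\<exists>U. openin X U \<and> K \<subseteq> U \<and> U \<subseteq> K')"

text \<open>The infimum is taken in \<open>[0,\<infinity>]\<close>, so the infimum of the empty set is \<open>\<infinity>\<close>: if a regular
  content exists then every compact set has a compact neighbourhood. With a real-valued
  \<open>Inf\<close> this would be lost.\<close>

locale regular_content = topological_content +
  assumes regular: "compactin X K \<Longrightarrow>
    ennreal (lam K) = (INF K'\<in>{K'. compactin X K' \<and> way_inside X K K'}. ennreal (lam K'))"

end

theory Submission
  imports Defs
begin

text \<open>Regularity says that a compact \<open>K\<close> has compact neighbourhoods of almost the same content.
  Removing the interior of such a neighbourhood from a larger compact \<open>C\<close> leaves a compact set
  disjoint from \<open>K\<close> whose content is almost \<open>lam C - lam K\<close>; so \<open>lam C - lam K\<close> is the supremum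
  of the contents of the compact subsets of \<open>C - K\<close> (\<open>lam_inner_difference\<close>) and depends only on
  the set \<open>C - K\<close>. As \<open>(A \<union> B) - B = A - (A \<inter> B)\<close>, modularity follows (\<open>lam_modular\<close>).

  For the almost Boolean property of a chain \<open>s n \<subseteq> c\<close>, enclose each \<open>s n\<close> in an open \<open>U n\<close> and
  that in a compact \<open>K n\<close> of content below \<open>lam (s n) + \<epsilon> / 2 ^ (n + 2)\<close>. By modularity the content
  of the union of the \<open>K k\<close> with \<open>k \<le> n\<close> exceeds \<open>lam (s n)\<close> by less than \<open>\<epsilon> / 2\<close>
  (\<open>lam_chain_enclosure\<close>), because the union up to \<open>n\<close> and \<open>K (n + 1)\<close> both contain \<open>s n\<close>.
  Then \<open>d = c - (\<Union>n. U n)\<close> is compact and disjoint from every \<open>s n\<close>. It is a decreasing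
  intersection of compact sets, along which a regular content is continuous
  (\<open>lam_continuous_from_above\<close>), so that \<open>lam d\<close> is at least \<open>lam c - (SUP n. lam (s n)) - \<epsilon> / 2\<close>.
  An \<open>N\<close> for which \<open>lam (s N)\<close> comes within \<open>\<epsilon> / 2\<close> of the supremum finishes the proof.\<close>

lemma Hausdorff_compactin_Diff:
  assumes "Hausdorff_space X" "compactin X C" "openin X U"
  shows "compactin X (C - U)"
  by (meson Diff_subset assms closed_compactin closedin_diff compactin_imp_closedin)

context regular_content
begin

lemma lam_empty: "lam {} = 0"
  using additive[of "{}" "{}"] by simp

lemma outer_approximation:
  assumes "compactin X K" "0 < e"
  obtains U K' where "openin X U" "compactin X K'" "K \<subseteq> U" "U \<subseteq> K'" "lam K' < lam K + e"
proof -
  have "ennreal (lam K) < ennreal (lam K + e)"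
    using assms nonneg[of K] by (simp add: ennreal_less_iff)
  then obtain K' where K': "compactin X K'" "way_inside X K K'"
      "ennreal (lam K') < ennreal (lam K + e)"
    unfolding regular[OF assms(1)] INF_less_iff by blast
  then have "lam K' < lam K + e"
    using nonneg[of K'] by (simp add: ennreal_less_iff)
  with K' that show thesis
    unfolding way_inside_def by blast
qed

text \<open>The witness is \<open>C - U\<close>, where \<open>U\<close> is an open set containing \<open>K\<close> that lies in a compact set
  of content less than \<open>lam K + e\<close>.\<close>

lemma lam_inner_difference:
  assumes "Hausdorff_space X" "compactin X C" "compactin X K" "0 < e"
  obtains L where "compactin X L" "L \<subseteq> C - K" "lam C < lam K + lam L + e"
proof -
  obtain U K' where U: "openin X U" "compactin X K'" "K \<subseteq> U" "U \<subseteq> K'" "lam K' < lam K + e"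
    using outer_approximation[OF assms(3,4)] by blast
  have L: "compactin X (C - U)"
    using assms U by (intro Hausdorff_compactin_Diff)
  have "lam C \<le> lam ((C - U) \<union> K')"
    using assms L U by (intro mono compactin_Un) auto
  also have "\<dots> \<le> lam (C - U) + lam K'"
    using L U by (intro subadditive)
  finally show thesis
    using that[OF L] U by auto
qed

lemma lam_modular:
  assumes "Hausdorff_space X" and A: "compactin X A" and B: "compactin X B"
  shows "lam A + lam B = lam (A \<union> B) + lam (A \<inter> B)"
proof (rule antisym; rule field_le_epsilon)
  fix e :: real
  assume "0 < e"
  have Un: "compactin X (A \<union> B)" and Int: "compactin X (A \<inter> B)"
    using assms by (auto simp: compactin_Un compactin_Int)
  {
    obtain L where L: "compactin X L" "L \<subseteq> A - A \<inter> B" "lam A < lam (A \<inter> B) + lam L + e"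
      using lam_inner_difference[OF assms(1) A Int \<open>0 < e\<close>] .
    have "lam B + lam L = lam (B \<union> L)"
      using B L by (intro additive[symmetric]) auto
    also have "\<dots> \<le> lam (A \<union> B)"
      using A B L Un by (intro mono compactin_Un) auto
    finally show "lam A + lam B \<le> lam (A \<union> B) + lam (A \<inter> B) + e"
      using L by simp
  }
  {
    obtain L where L: "compactin X L" "L \<subseteq> (A \<union> B) - B" "lam (A \<union> B) < lam B + lam L + e"
      using lam_inner_difference[OF assms(1) Un B \<open>0 < e\<close>] .
    have "lam (A \<inter> B) + lam L = lam (A \<inter> B \<union> L)"
      using Int L by (intro additive[symmetric]) auto
    also have "\<dots> \<le> lam A"
      using A L Int by (intro mono compactin_Un) auto
    finally show "lam (A \<union> B) + lam (A \<inter> B) \<le> lam A + lam B + e"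
      using L by simp
  }
qed

text \<open>By compactness some \<open>K n\<close> lies in any given open neighbourhood of the intersection, in
  particular in one that regularity provides.\<close>

lemma lam_continuous_from_above:
  assumes "Hausdorff_space X" "\<And>n::nat. compactin X (K n)" "decseq K" "0 < e"
  obtains n where "lam (K n) < lam (\<Inter>n. K n) + e"
proof -
  have closed: "closedin X (K n)" for n
    using assms by (intro compactin_imp_closedin)
  have "compactin X (\<Inter>n. K n)"
    by (rule closed_compactin[OF assms(2)[of 0]]) (use closed in auto)
  then obtain U K' where U: "openin X U" "compactin X K'" "(\<Inter>n. K n) \<subseteq> U" "U \<subseteq> K'"
      "lam K' < lam (\<Inter>n. K n) + e"
    using outer_approximation assms(4) by blast
  \<comment> \<open>The complements of the \<open>K n\<close> form an increasing open cover of the compact set \<open>K 0 - U\<close>.\<close>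
  have "compactin X (K 0 - U)"
    using assms U by (intro Hausdorff_compactin_Diff)
  moreover have "K 0 - U \<subseteq> (\<Union>n. topspace X - K n)"
    using U(3) compactin_subset_topspace[OF assms(2)[of 0]] by auto
  moreover have "openin X T" if "T \<in> range (\<lambda>n. topspace X - K n)" for T
    using that closed by auto
  ultimately obtain F where F: "finite F" "F \<subseteq> range (\<lambda>n. topspace X - K n)" "K 0 - U \<subseteq> \<Union>F"
    using compactinD[of X "K 0 - U" "range (\<lambda>n. topspace X - K n)"] by blast
  then obtain I where I: "finite I" "F = (\<lambda>n. topspace X - K n) ` I"
    by (meson finite_subset_image)
  define n where "n = Max (insert 0 I)"
  have "K n \<subseteq> K i" if "i \<in> insert 0 I" for i
    using that I(1) unfolding n_def by (intro decseqD[OF assms(3)] Max_ge) auto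
  then have "K n \<subseteq> U"
    using F(3) I(2) by blast
  then have "lam (K n) \<le> lam K'"
    using assms U by (intro mono) auto
  then show thesis
    using that[of n] U(5) by linarith
qed

text \<open>Adding the enclosure \<open>K n\<close> of \<open>s (Suc n)\<close> to the earlier ones, which already contain
  \<open>s n\<close>, counts the overlap \<open>s n\<close> only once. The errors therefore add up instead of the contents
  themselves.\<close>

lemma lam_chain_enclosure:
  assumes "Hausdorff_space X"
    and s: "\<And>n::nat. compactin X (s n)" "\<And>n. s n \<subseteq> s (Suc n)"
    and K: "\<And>n. compactin X (K n)" "\<And>n. s n \<subseteq> K n"
    and e: "\<And>n. lam (K n) \<le> lam (s n) + e n"
  shows "lam (\<Union>k\<le>n. K k) \<le> lam (s n) + (\<Sum>k\<le>n. e k)"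
proof (induction n)
  case 0
  show ?case
    using e[of 0] by simp
next
  case (Suc n)
  let ?W = "\<Union>k\<le>n. K k"
  have W: "compactin X ?W"
    using K by (intro compactin_Union) auto
  have "s n \<subseteq> ?W \<inter> K (Suc n)"
    using s(2)[of n] K(2)[of n] K(2)[of "Suc n"] by auto
  then have "lam (s n) \<le> lam (?W \<inter> K (Suc n))"
    using assms W by (intro mono compactin_Int) auto
  moreover have "lam ?W + lam (K (Suc n)) = lam (?W \<union> K (Suc n)) + lam (?W \<inter> K (Suc n))"
    using assms W by (intro lam_modular)
  ultimately have "lam (?W \<union> K (Suc n)) \<le> lam (s (Suc n)) + ((\<Sum>k\<le>n. e k) + e (Suc n))"
    using Suc e[of "Suc n"] by linarith
  then show ?case
    by (simp add: atMost_Suc Un_commute)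
qed

text \<open>Stronger than the almost Boolean property asks: the approximate complement \<open>d\<close> is disjoint
  from the whole chain, not merely up to content zero.\<close>

lemma approximate_complement_of_chain:
  assumes "Hausdorff_space X" and c: "compactin X c"
    and s: "\<And>n::nat. compactin X (s n)" "\<And>n. s n \<subseteq> s (Suc n)" "\<And>n. s n \<subseteq> c"
    and "0 < \<epsilon>"
  obtains d N where "compactin X d" "d \<subseteq> c" "d \<inter> (\<Union>n. s n) = {}"
    "lam c - lam (d \<union> s N) < \<epsilon>"
proof -
  have "\<exists>U K. openin X U \<and> compactin X K \<and> s n \<subseteq> U \<and> U \<subseteq> K
      \<and> lam K < lam (s n) + \<epsilon> / 4 * (1/2) ^ n" for n
    using outer_approximation[OF s(1)[of n], of "\<epsilon> / 4 * (1/2) ^ n"] \<open>0 < \<epsilon>\<close>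
    by (metis divide_pos_pos mult_pos_pos zero_less_numeral zero_less_one zero_less_power)
  then obtain U K where U: "\<And>n. openin X (U n)" "\<And>n. s n \<subseteq> U n" "\<And>n. U n \<subseteq> K n"
      and K: "\<And>n. compactin X (K n)" "\<And>n. lam (K n) < lam (s n) + \<epsilon> / 4 * (1/2) ^ n"
    by metis
  define V W where "V = (\<lambda>n. \<Union>k\<le>n. U k)" and "W = (\<lambda>n. \<Union>k\<le>n. K k)"
  have V: "openin X (V n)" and W: "compactin X (W n)" for n
    using U(1) K(1) unfolding V_def W_def by (auto intro: compactin_Union)
  have "V n \<subseteq> W n" for n
    unfolding V_def W_def by (intro UN_mono order_refl U(3))
  have cV: "compactin X (c - V n)" for n
    using assms V by (intro Hausdorff_compactin_Diff)
  have "s n \<subseteq> K n" for n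
    using U by blast
  then have "lam (W n) \<le> lam (s n) + (\<Sum>k\<le>n. \<epsilon> / 4 * (1/2) ^ k)" for n
    unfolding W_def
    by (intro lam_chain_enclosure assms(1) s(1,2) K(1) less_imp_le[OF K(2)])
  moreover have "(\<Sum>k\<le>n. \<epsilon> / 4 * (1/2) ^ k) < \<epsilon> / 2" for n :: nat
  proof -
    have "(\<Sum>k\<le>n. (1/2::real) ^ k) < 2"
      using sum_gp_strict[of "1/2::real" "Suc n"] by (simp add: lessThan_Suc_atMost)
    then have "\<epsilon> / 4 * (\<Sum>k\<le>n. (1/2) ^ k) < \<epsilon> / 4 * 2"
      using \<open>0 < \<epsilon>\<close> by (intro mult_strict_left_mono) auto
    then show ?thesis
      unfolding sum_distrib_left by simp
  qed
  ultimately have W_bound: "lam (W n) < lam (s n) + \<epsilon> / 2" for n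
    by (meson add_strict_left_mono le_less_trans)
  have bdd: "bdd_above (range (\<lambda>n. lam (s n)))"
    using mono[OF s(1) c s(3)] by (intro bdd_aboveI2)
  define S where "S = (SUP n. lam (s n))"
  have S: "lam (s n) \<le> S" for n
    unfolding S_def by (rule cSUP_upper[OF UNIV_I bdd])
  have cV_bound: "lam c - S - \<epsilon> / 2 < lam (c - V n)" for n
  proof -
    have "lam c \<le> lam ((c - V n) \<union> W n)"
      using c cV \<open>V n \<subseteq> W n\<close> W by (intro mono compactin_Un) auto
    also have "\<dots> \<le> lam (c - V n) + lam (W n)"
      using cV W by (intro subadditive)
    finally show ?thesis
      using W_bound[of n] S[of n] by linarith
  qed
  define d where "d = (\<Inter>n. c - V n)"
  have d_eq: "d = c - (\<Union>n. U n)"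
    unfolding d_def V_def by auto
  have d: "compactin X d"
    unfolding d_eq using assms U by (intro Hausdorff_compactin_Diff) auto
  have disjoint: "d \<inter> s n = {}" for n
    using U(2)[of n] d_eq by auto
  have dec: "decseq (\<lambda>n. c - V n)"
    unfolding V_def by (intro decseq_SucI) (auto simp: atMost_Suc)
  have d_bound: "lam c - S - \<epsilon> / 2 \<le> lam d"
  proof (rule field_le_epsilon)
    fix e :: real
    assume "0 < e"
    then obtain n where "lam (c - V n) < lam d + e"
      unfolding d_def
      by (rule lam_continuous_from_above[where K = "\<lambda>n. c - V n", OF assms(1) cV dec])
    then show "lam c - S - \<epsilon> / 2 \<le> lam d + e"
      using cV_bound[of n] by linarith
  qed
  have "S - \<epsilon> / 2 < S"
    using \<open>0 < \<epsilon>\<close> by simp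
  then obtain N where "S - \<epsilon> / 2 < lam (s N)"
    unfolding S_def less_cSUP_iff[OF UNIV_not_empty bdd] by blast
  moreover have "lam (d \<union> s N) = lam d + lam (s N)"
    using d s(1) disjoint by (intro additive)
  ultimately have "lam c - lam (d \<union> s N) < \<epsilon>"
    using d_bound by linarith
  moreover have "d \<subseteq> c"
    unfolding d_eq by (rule Diff_subset)
  moreover have "d \<inter> (\<Union>n. s n) = {}"
    unfolding Int_UN_distrib disjoint by simp
  ultimately show thesis
    using that[OF d] by simp
qed

end

theorem theorem1p5:
  fixes X :: "'a topology" and lam :: "'a set \<Rightarrow> real"
  assumes "Hausdorff_space X"
    and "regular_content X lam"
  shows "almost_Boolean_valuation (compacts X) lam"
proof -
  interpret regular_content X lam
    by fact
  interpret lower_bounded_distrib_lattice "compacts X"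
    using assms(1) by (rule lower_bounded_distrib_lattice_compacts)
  show ?thesis
  proof (unfold_locales, goal_cases)
    case (1 K)
    then show ?case by (simp add: nonneg)
  next
    case (2 K K')
    then show ?case by (simp add: mono)
  next
    case 3
    show ?case by (simp add: bottom_compacts lam_empty)
  next
    case (4 K K')
    then show ?case
      using lam_modular[OF assms(1)] by (simp add: join_compacts meet_compacts assms(1))
  next
    case (5 c s \<epsilon>)
    then have s: "compactin X c" "\<And>n. compactin X (s n)" "\<And>n. s n \<subseteq> s (Suc n)" "\<And>n. s n \<subseteq> c"
      by simp_all
    obtain d N where d: "compactin X d" "d \<subseteq> c" "d \<inter> (\<Union>n. s n) = {}"
        "lam c - lam (d \<union> s N) < \<epsilon>"
      using approximate_complement_of_chain[where c = c and s = s, OF assms(1) s \<open>0 < \<epsilon>\<close>] .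
    have "d \<inter> s n = {}" for n
      using d(3) by blast
    then have "lam (d \<sqinter>\<^bsub>compacts X\<^esub> s n) = 0" for n
      by (simp only: meet_compacts[OF assms(1) d(1) s(2)] lam_empty)
    moreover have "lam c - lam (d \<squnion>\<^bsub>compacts X\<^esub> s N) < \<epsilon>"
      using d(4) by (simp only: join_compacts[OF d(1) s(2)])
    ultimately show ?case
      using d(1,2) by (intro exI[of _ N] bexI[of _ d] conjI allI) simp_all
  qed
qed

end
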